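(* Let $Z\in\{1,L\}$. Let $\mathbf{A}_{\mathrm{sum}}$ be an optimal solution of $$\max_{\mathbf{A}}\ \min_{k,l}\ \mathrm{SINR}^{[kl]}(\mathbf{A})\quad\text{subject to}\quad\sum_{j=1}^L\gamma_j(\mathbf{A})\le Z,$$ and let $\mathbf{A}_{\mathrm{per}}=\mathbf{A}_{\mathrm{sum}}\big/\sqrt{\max_{j}\gamma_j(\mathbf{A}_{\mathrm{sum}})}$ (i.e. the beamforming vectors are kept and all powers are divided by $\max_j\gamma_j(\mathbf{A}_{\mathrm{sum}})$). Then $\mathbf{A}_{\mathrm{per}}$ satisfies the individual power constraints $\gamma_j(\mathbf{A}_{\mathrm{per}})\le1$, $j=1,\dots,L$, and $$\mathrm{SINR}^{[kl]}(\mathbf{A}_{\mathrm{per}})\ \ge\ \frac1L\,\mathrm{SINR}_{\mathrm{per}}^{\mathrm{o}}\qquad\text{for all }k,l,$$ where $\mathrm{SINR}_{\mathrm{per}}^{\mathrm{o}}$ is the optimal value of $\max_{\mathbf{A}}\min_{k,l}\mathrm{SINR}^{[kl]}(\mathbf{A})$ subject to $\gamma_j(\mathbf{A})\le1$, $j=1,\dots,L$.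
   Context: $K,L,M$ are positive integers; $\rho_f,\rho_r,\tau>0$ are real; $\beta_j^{[kl]}>0$ for $j,l\in\{1,\dots,L\}$, $k\in\{1,\dots,K\}$ (superscripts in square brackets are indices). The variable $\mathbf{A}$ is the collection of real precoding coefficients $\alpha_j^{[kl]}$, $j,l\in\{1,\dots,L\}$, $k\in\{1,\dots,K\}$; multiplying $\mathbf{A}$ by a scalar multiplies every $\alpha_j^{[kl]}$ by it. Define $$J_0^{[kl]}=\rho_f\rho_r\tau\Big|\sum_{j=1}^L\beta_j^{[kl]}\alpha_j^{[kl]}\Big|^2,\qquad J_1^{[kl]}=\rho_f\rho_r\tau\sum_{v\ne l}\Big|\sum_{j=1}^L\beta_j^{[kl]}\alpha_j^{[kv]}\Big|^2,$$ $$J_2^{[kl]}=\rho_f\sum_{j=1}^L\sum_{n=1}^K\beta_j^{[kl]}\Big(1+\rho_r\tau\sum_{s=1}^L\beta_j^{[ns]}\Big)\sum_{v=1}^L|\alpha_j^{[nv]}|^2,$$ $$\mathrm{SINR}^{[kl]}(\mathbf{A})=\frac{MJ_0^{[kl]}}{\frac1M+MJ_1^{[kl]}+J_2^{[kl]}},\qquad \gamma_j(\mathbf{A})=M\sum_{k=1}^K\Big(1+\rho_r\tau\sum_{s=1}^L\beta_j^{[ks]}\Big)\sum_{v=1}^L|\alpha_j^{[kv]}|^2 .$$ *)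

theory Defs
  imports Complex_Main
begin

(* Multi-cell system: L cells, K users per cell, M antennas per base station, forward and
   reverse link powers rho_f and rho_r, pilot length tau. gain S j k l is beta_j^[kl]. *)
record cell_system =
  cells :: nat
  users :: nat
  antennas :: nat
  fwd_power :: real
  rev_power :: real
  pilot_len :: real
  gain :: "nat \<Rightarrow> nat \<Rightarrow> nat \<Rightarrow> real"

(* A j k l is alpha_j^[kl]. Cells are numbered 1..L and users 1..K; entries with an index
   outside these ranges are never consulted. *)
type_synonym precoding = "nat \<Rightarrow> nat \<Rightarrow> nat \<Rightarrow> real"

definition scale :: "real \<Rightarrow> precoding \<Rightarrow> precoding" where
  "scale c A = (\<lambda>j k l. c * A j k l)"

definition J0 :: "cell_system \<Rightarrow> precoding \<Rightarrow> nat \<Rightarrow> nat \<Rightarrow> real" where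
  "J0 S A k l = fwd_power S * rev_power S * pilot_len S *
     \<bar>\<Sum>j=1..cells S. gain S j k l * A j k l\<bar>\<^sup>2"

definition J1 :: "cell_system \<Rightarrow> precoding \<Rightarrow> nat \<Rightarrow> nat \<Rightarrow> real" where
  "J1 S A k l = fwd_power S * rev_power S * pilot_len S *
     (\<Sum>v\<in>{1..cells S} - {l}. \<bar>\<Sum>j=1..cells S. gain S j k l * A j k v\<bar>\<^sup>2)"

definition J2 :: "cell_system \<Rightarrow> precoding \<Rightarrow> nat \<Rightarrow> nat \<Rightarrow> real" where
  "J2 S A k l = fwd_power S *
     (\<Sum>j=1..cells S. \<Sum>n=1..users S.
        gain S j k l * (1 + rev_power S * pilot_len S * (\<Sum>s=1..cells S. gain S j n s)) *
        (\<Sum>v=1..cells S. \<bar>A j n v\<bar>\<^sup>2))"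

definition SINR :: "cell_system \<Rightarrow> precoding \<Rightarrow> nat \<Rightarrow> nat \<Rightarrow> real" where
  "SINR S A k l = real (antennas S) * J0 S A k l /
     (1 / real (antennas S) + real (antennas S) * J1 S A k l + J2 S A k l)"

definition cell_power :: "cell_system \<Rightarrow> precoding \<Rightarrow> nat \<Rightarrow> real" where
  "cell_power S A j = real (antennas S) *
     (\<Sum>k=1..users S.
        (1 + rev_power S * pilot_len S * (\<Sum>s=1..cells S. gain S j k s)) *
        (\<Sum>v=1..cells S. \<bar>A j k v\<bar>\<^sup>2))"

definition max_cell_power :: "cell_system \<Rightarrow> precoding \<Rightarrow> real" where
  "max_cell_power S A = (MAX j\<in>{1..cells S}. cell_power S A j)"

definition min_SINR :: "cell_system \<Rightarrow> precoding \<Rightarrow> real" where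
  "min_SINR S A = (MIN (k, l)\<in>{1..users S} \<times> {1..cells S}. SINR S A k l)"

definition sum_power_feasible :: "cell_system \<Rightarrow> real \<Rightarrow> precoding \<Rightarrow> bool" where
  "sum_power_feasible S Z A \<longleftrightarrow> (\<Sum>j=1..cells S. cell_power S A j) \<le> Z"

definition per_power_feasible :: "cell_system \<Rightarrow> precoding \<Rightarrow> bool" where
  "per_power_feasible S A \<longleftrightarrow> (\<forall>j\<in>{1..cells S}. cell_power S A j \<le> 1)"

definition sum_optimal :: "cell_system \<Rightarrow> real \<Rightarrow> precoding \<Rightarrow> bool" where
  "sum_optimal S Z A \<longleftrightarrow> is_arg_max (min_SINR S) (sum_power_feasible S Z) A"

(* For positive parameters the feasible values form a nonempty bounded set (the per-cell
   constraints bound every relevant coefficient), so this Sup is a genuine supremum. *)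
definition SINR_per_opt :: "cell_system \<Rightarrow> real" where
  "SINR_per_opt S = (SUP A\<in>{A. per_power_feasible S A}. min_SINR S A)"

end

(* Multiplying all coefficients by c multiplies all powers by c^2, and lowers every SINR at most
   by the factor min 1 (c^2), because the noise 1/M is not scaled.  A precoding B feasible for the
   individual constraints has total power at most L, so sqrt (Z/L) * B competes with A_sum, whence
   min_SINR A_sum >= (Z/L) * min_SINR B.  On the other hand the largest power of A_sum is at most Z,
   so passing to A_per loses at most the factor 1/Z.  The product of the two losses is 1/L for every
   Z in [1,L]. *)
theory Submission
  imports Defs
begin

section \<open>Quadratic scaling of signal, interference and power\<close>

lemma J0_scale: "J0 S (scale c A) k l = c\<^sup>2 * J0 S A k l"
  by (simp add: J0_def scale_def mult.left_commute[of _ c] sum_distrib_left[symmetric]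
      abs_mult power_mult_distrib)

lemma J1_scale: "J1 S (scale c A) k l = c\<^sup>2 * J1 S A k l"
  by (simp add: J1_def scale_def mult.left_commute[of _ c] sum_distrib_left[symmetric]
      abs_mult power_mult_distrib)

lemma J2_scale: "J2 S (scale c A) k l = c\<^sup>2 * J2 S A k l"
  by (simp add: J2_def scale_def abs_mult power_mult_distrib sum_distrib_left[symmetric]
      mult.left_commute[of _ "c\<^sup>2"])

lemma cell_power_scale: "cell_power S (scale c A) j = c\<^sup>2 * cell_power S A j"
  by (simp add: cell_power_def scale_def abs_mult power_mult_distrib sum_distrib_left[symmetric]
      mult.left_commute[of _ "c\<^sup>2"])

lemma le_max_cell_power:
  "j \<in> {1..cells S} \<Longrightarrow> cell_power S A j \<le> max_cell_power S A"
  unfolding max_cell_power_def by (intro Max_ge) auto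

lemma min_SINR_le:
  assumes "k \<in> {1..users S}" "l \<in> {1..cells S}"
  shows "min_SINR S A \<le> SINR S A k l"
  unfolding min_SINR_def by (intro Min_le) (use assms in force)+

text \<open>Collects the standing positivity assumptions; gains are constrained only at indices that
  the formulas consult.\<close>

locale positive_system =
  fixes S :: cell_system
  assumes cells_pos: "cells S > 0" and users_pos: "users S > 0" and antennas_pos: "antennas S > 0"
    and fwd_pos: "fwd_power S > 0" and rev_pos: "rev_power S > 0" and pilot_pos: "pilot_len S > 0"
    and gain_pos: "\<And>j k l. \<lbrakk>j \<in> {1..cells S}; k \<in> {1..users S}; l \<in> {1..cells S}\<rbrakk>
      \<Longrightarrow> gain S j k l > 0"
begin

section \<open>Signs of the SINR terms and behaviour of SINR under scaling\<close>

lemma min_SINR_greatest: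
  assumes "\<And>k l. \<lbrakk>k \<in> {1..users S}; l \<in> {1..cells S}\<rbrakk> \<Longrightarrow> x \<le> SINR S A k l"
  shows "x \<le> min_SINR S A"
  unfolding min_SINR_def using cells_pos users_pos assms by (subst Min_ge_iff) auto

lemma min_SINR_pos:
  assumes "\<And>k l. \<lbrakk>k \<in> {1..users S}; l \<in> {1..cells S}\<rbrakk> \<Longrightarrow> SINR S A k l > 0"
  shows "min_SINR S A > 0"
  unfolding min_SINR_def using cells_pos users_pos assms by (subst Min_gr_iff) auto

lemma weight_pos:
  assumes "j \<in> {1..cells S}" "k \<in> {1..users S}"
  shows "1 + rev_power S * pilot_len S * (\<Sum>s=1..cells S. gain S j k s) > 0"
proof -
  have "(\<Sum>s=1..cells S. gain S j k s) \<ge> 0"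
    using gain_pos assms by (intro sum_nonneg) (auto intro: less_imp_le)
  then show ?thesis
    using rev_pos pilot_pos by (simp add: add_pos_nonneg)
qed

lemma J0_nonneg: "J0 S A k l \<ge> 0"
  using fwd_pos rev_pos pilot_pos by (simp add: J0_def)

lemma J1_nonneg: "J1 S A k l \<ge> 0"
  using fwd_pos rev_pos pilot_pos by (simp add: J1_def sum_nonneg)

lemma J2_nonneg:
  assumes "k \<in> {1..users S}" "l \<in> {1..cells S}"
  shows "J2 S A k l \<ge> 0"
  unfolding J2_def
proof (intro mult_nonneg_nonneg sum_nonneg)
  fix j n assume j: "j \<in> {1..cells S}" and n: "n \<in> {1..users S}"
  show "gain S j k l \<ge> 0"
    using gain_pos[OF j assms] by simp
  show "1 + rev_power S * pilot_len S * (\<Sum>s=1..cells S. gain S j n s) \<ge> 0"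
    using weight_pos[OF j n] by simp
qed (use fwd_pos in auto)

lemma SINR_denominator_pos:
  assumes "k \<in> {1..users S}" "l \<in> {1..cells S}"
  shows "1 / real (antennas S) + real (antennas S) * J1 S A k l + J2 S A k l > 0"
  using antennas_pos J1_nonneg[of A k l] J2_nonneg[OF assms, of A]
  by (intro add_pos_nonneg) auto

text \<open>The denominator is positive and \<open>J0\<close> is a positive multiple of a square, so
  only the vanishing of the received signal matters.\<close>

lemma SINR_pos_iff:
  assumes "k \<in> {1..users S}" "l \<in> {1..cells S}"
  shows "SINR S A k l > 0 \<longleftrightarrow> (\<Sum>j=1..cells S. gain S j k l * A j k l) \<noteq> 0"
  using SINR_denominator_pos[OF assms, of A] antennas_pos fwd_pos rev_pos pilot_pos
  by (simp add: SINR_def J0_def zero_less_divide_iff zero_less_mult_iff)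

text \<open>Write the SINR as x / (d + e) with noise d and interference e. Scaling turns it into c^2
  x / (d + c^2 e), so the claim reduces to a comparison of denominators. Having \<open>t\<close>
  separate from \<open>c\<close> covers scaling both up and down.\<close>

lemma SINR_scale_ge:
  assumes kl: "k \<in> {1..users S}" "l \<in> {1..cells S}" and t: "t \<le> 1" "t \<le> c\<^sup>2"
  shows "t * SINR S A k l \<le> SINR S (scale c A) k l"
proof -
  define x where "x = real (antennas S) * J0 S A k l"
  define d where "d = 1 / real (antennas S)"
  define e where "e = real (antennas S) * J1 S A k l + J2 S A k l"
  have x: "x \<ge> 0" and d: "d > 0" and e: "e \<ge> 0"
    using antennas_pos J0_nonneg J1_nonneg J2_nonneg[OF kl] by (auto simp: x_def d_def e_def)
  have pos: "d + e > 0" "d + c\<^sup>2 * e > 0"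
    using d e by (simp_all add: add_pos_nonneg)
  have "t * (d + c\<^sup>2 * e) \<le> c\<^sup>2 * (d + e)"
  proof -
    \<comment> \<open>The noise term uses \<open>t \<le> c\<^sup>2\<close>, the interference term
      uses \<open>t \<le> 1\<close>.\<close>
    have "t * d \<le> c\<^sup>2 * d" and "t * (c\<^sup>2 * e) \<le> 1 * (c\<^sup>2 * e)"
      using t d e by (intro mult_right_mono; simp)+
    then show ?thesis
      by (simp add: algebra_simps)
  qed
  then have "x * (t * (d + c\<^sup>2 * e)) \<le> x * (c\<^sup>2 * (d + e))"
    using x by (rule mult_left_mono)
  then have "t * (x / (d + e)) \<le> c\<^sup>2 * x / (d + c\<^sup>2 * e)"
    using pos by (simp add: divide_simps mult_ac)
  then show ?thesis
    by (simp add: SINR_def J0_scale J1_scale J2_scale x_def d_def e_def algebra_simps)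
qed

lemma min_SINR_scale_ge:
  assumes "0 \<le> t" "t \<le> 1" "t \<le> c\<^sup>2"
  shows "t * min_SINR S A \<le> min_SINR S (scale c A)"
proof (rule min_SINR_greatest)
  fix k l assume kl: "k \<in> {1..users S}" "l \<in> {1..cells S}"
  have "t * min_SINR S A \<le> t * SINR S A k l"
    using min_SINR_le[OF kl] assms(1) by (rule mult_left_mono)
  also have "\<dots> \<le> SINR S (scale c A) k l"
    using kl assms(2,3) by (rule SINR_scale_ge)
  finally show "t * min_SINR S A \<le> SINR S (scale c A) k l" .
qed

section \<open>Cell powers and their link to positive SINR\<close>

lemma cell_power_nonneg:
  assumes "j \<in> {1..cells S}"
  shows "cell_power S A j \<ge> 0"
  unfolding cell_power_def
  by (intro mult_nonneg_nonneg sum_nonneg less_imp_le[OF weight_pos[OF assms]]) auto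

lemma cell_power_pos:
  assumes j: "j \<in> {1..cells S}" and k: "k \<in> {1..users S}" and l: "l \<in> {1..cells S}"
    and nz: "A j k l \<noteq> 0"
  shows "cell_power S A j > 0"
proof -
  have "(\<Sum>v=1..cells S. \<bar>A j k v\<bar>\<^sup>2) > 0"
    by (rule sum_pos2[OF _ l]) (use nz in auto)
  then have "0 < (1 + rev_power S * pilot_len S * (\<Sum>s=1..cells S. gain S j k s)) *
      (\<Sum>v=1..cells S. \<bar>A j k v\<bar>\<^sup>2)"
    using weight_pos[OF j k] by simp
  then have "0 < (\<Sum>k=1..users S.
      (1 + rev_power S * pilot_len S * (\<Sum>s=1..cells S. gain S j k s)) *
      (\<Sum>v=1..cells S. \<bar>A j k v\<bar>\<^sup>2))"
    by (rule sum_pos2[OF finite_atLeastAtMost k])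
      (intro mult_nonneg_nonneg sum_nonneg less_imp_le[OF weight_pos[OF j]]; simp)
  then show ?thesis
    using antennas_pos by (simp add: cell_power_def)
qed

lemma sum_cell_power_nonneg: "(\<Sum>j=1..cells S. cell_power S A j) \<ge> 0"
  by (intro sum_nonneg cell_power_nonneg)

lemma max_cell_power_le_sum: "max_cell_power S A \<le> (\<Sum>j=1..cells S. cell_power S A j)"
  unfolding max_cell_power_def
  using cells_pos by (auto intro!: Max.boundedI member_le_sum cell_power_nonneg)

text \<open>A positive SINR of one user forces a nonzero coefficient, and every nonzero coefficient
  costs power in its cell.\<close>

lemma max_cell_power_pos:
  assumes "min_SINR S A > 0"
  shows "max_cell_power S A > 0"
proof -
  have one: "1 \<in> {1..users S}" "1 \<in> {1..cells S}"
    using users_pos cells_pos by auto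
  have "SINR S A 1 1 > 0"
    using assms min_SINR_le[OF one, of A] by linarith
  then have "(\<Sum>j=1..cells S. gain S j 1 1 * A j 1 1) \<noteq> 0"
    using SINR_pos_iff[OF one] by simp
  then obtain j where j: "j \<in> {1..cells S}" and "gain S j 1 1 * A j 1 1 \<noteq> 0"
    by (meson sum.neutral)
  then have "cell_power S A j > 0"
    using cell_power_pos[OF j one] by simp
  then show ?thesis
    using le_max_cell_power[OF j, of A] by linarith
qed

text \<open>Competitor showing that an optimum has positive value. The all-ones precoding, scaled to
  fit the budget, reaches every user because all gains are positive.\<close>

lemma exists_sum_feasible_min_SINR_pos:
  assumes "Z > 0"
  shows "\<exists>A. sum_power_feasible S Z A \<and> min_SINR S A > 0"
proof -
  define P where "P = (\<Sum>j=1..cells S. cell_power S (\<lambda>_ _ _. 1) j)"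
  \<comment> \<open>The summand 1 keeps the denominator positive, and P / (1 + P) \<le> 1 still
    keeps the total power within \<open>Z\<close>.\<close>
  define c where "c = sqrt (Z / (1 + P))"
  define A where "A = scale c (\<lambda>_ _ _. 1)"
  have P: "P \<ge> 0"
    unfolding P_def by (rule sum_cell_power_nonneg)
  have c: "c > 0" "c\<^sup>2 = Z / (1 + P)"
    using P assms by (simp_all add: c_def)
  have "c\<^sup>2 * P \<le> Z"
    using P assms by (simp add: c(2) field_simps)
  then have "sum_power_feasible S Z A"
    by (simp add: sum_power_feasible_def A_def cell_power_scale P_def sum_distrib_left)
  moreover have "min_SINR S A > 0"
  proof (rule min_SINR_pos)
    fix k l assume kl: "k \<in> {1..users S}" "l \<in> {1..cells S}"
    have "(\<Sum>j=1..cells S. gain S j k l * A j k l) > 0"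
      using gain_pos[OF _ kl] c(1) cells_pos
      by (intro sum_pos) (auto simp: A_def scale_def)
    then show "SINR S A k l > 0"
      by (simp add: SINR_pos_iff[OF kl])
  qed
  ultimately show ?thesis
    by blast
qed

section \<open>Comparing the optimum with individually constrained precodings\<close>

lemma sum_optimal_ge:
  assumes "sum_optimal S Z A" "sum_power_feasible S Z B"
  shows "min_SINR S B \<le> min_SINR S A"
  using assms by (auto simp: sum_optimal_def is_arg_max_linorder)

lemma sum_power_feasible_scale:
  assumes "per_power_feasible S B" "Z \<ge> 0"
  shows "sum_power_feasible S Z (scale (sqrt (Z / real (cells S))) B)"
proof -
  have "(\<Sum>j=1..cells S. cell_power S B j) \<le> (\<Sum>j=1..cells S. 1)"
    using assms(1) by (intro sum_mono) (auto simp: per_power_feasible_def)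
  then have "(\<Sum>j=1..cells S. cell_power S B j) \<le> real (cells S)"
    by simp
  then have "Z / real (cells S) * (\<Sum>j=1..cells S. cell_power S B j)
      \<le> Z / real (cells S) * real (cells S)"
    using assms(2) by (intro mult_left_mono) auto
  then show ?thesis
    using assms(2) cells_pos
    by (simp add: sum_power_feasible_def cell_power_scale sum_distrib_left)
qed

text \<open>The lower bound makes the normalization a division by a nonzero number; the upper bound
  limits its loss to the factor 1/Z.\<close>

lemma sum_optimal_max_cell_power:
  assumes "sum_optimal S Z A" "Z > 0"
  shows "0 < max_cell_power S A" "max_cell_power S A \<le> Z"
proof -
  obtain B where "sum_power_feasible S Z B" "min_SINR S B > 0"
    using exists_sum_feasible_min_SINR_pos[OF assms(2)] by blast
  then have "min_SINR S A > 0"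
    using sum_optimal_ge[OF assms(1)] by fastforce
  then show "0 < max_cell_power S A"
    by (rule max_cell_power_pos)
  show "max_cell_power S A \<le> Z"
    using assms(1) max_cell_power_le_sum[of A]
    by (simp add: sum_optimal_def is_arg_max_def sum_power_feasible_def)
qed

lemma per_power_feasible_normalized:
  assumes "max_cell_power S A > 0"
  shows "per_power_feasible S (scale (1 / sqrt (max_cell_power S A)) A)"
  using assms le_max_cell_power[of _ S A]
  by (auto simp: per_power_feasible_def cell_power_scale power_divide)

lemma SINR_normalized_ge:
  assumes opt: "sum_optimal S Z A" and Z: "1 \<le> Z" "Z \<le> real (cells S)"
    and kl: "k \<in> {1..users S}" "l \<in> {1..cells S}"
    and B: "per_power_feasible S B"
  shows "min_SINR S B / real (cells S)
    \<le> SINR S (scale (1 / sqrt (max_cell_power S A)) A) k l"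
proof -
  let ?m = "max_cell_power S A"
  have m: "0 < ?m" "?m \<le> Z"
    using sum_optimal_max_cell_power[OF opt] Z by auto
  have "min_SINR S B / real (cells S) = 1 / Z * (Z / real (cells S) * min_SINR S B)"
    using Z by simp
  also have "\<dots> \<le> 1 / Z * min_SINR S (scale (sqrt (Z / real (cells S))) B)"
    \<comment> \<open>Here t = c^2 = Z/L, which is at most 1 because \<open>Z\<close> is at most
      L.\<close>
    using Z by (intro mult_left_mono min_SINR_scale_ge) auto
  also have "\<dots> \<le> 1 / Z * min_SINR S A"
    using Z by (intro mult_left_mono sum_optimal_ge[OF opt] sum_power_feasible_scale B) auto
  also have "\<dots> \<le> 1 / Z * SINR S A k l"
    using Z by (intro mult_left_mono min_SINR_le kl) auto
  also have "\<dots> \<le> SINR S (scale (1 / sqrt ?m) A) k l"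
    \<comment> \<open>Here t = 1/Z and c^2 = 1/?m: \<open>t \<le> 1\<close> comes from
      \<open>1 \<le> Z\<close>, and \<open>t \<le> c\<^sup>2\<close> from
      \<open>?m \<le> Z\<close>.\<close>
    using Z m by (intro SINR_scale_ge kl) (auto simp: power_divide intro: divide_left_mono)
  finally show ?thesis .
qed

end

theorem mainTheorem4:
  fixes S :: cell_system and Z :: real and A_sum A_per :: precoding
  assumes "cells S > 0" and "users S > 0" and "antennas S > 0"
    and "fwd_power S > 0" and "rev_power S > 0" and "pilot_len S > 0"
    and "\<And>j k l. \<lbrakk>j \<in> {1..cells S}; k \<in> {1..users S}; l \<in> {1..cells S}\<rbrakk> \<Longrightarrow> gain S j k l > 0"
    and "Z \<in> {1, real (cells S)}"
    and "sum_optimal S Z A_sum"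
    and "A_per = scale (1 / sqrt (max_cell_power S A_sum)) A_sum"
  shows "per_power_feasible S A_per \<and>
    (\<forall>k\<in>{1..users S}. \<forall>l\<in>{1..cells S}.
       SINR S A_per k l \<ge> 1 / real (cells S) * SINR_per_opt S)"
proof (intro conjI ballI)
  interpret positive_system S
    by unfold_locales (use assms in auto)
  have Z: "1 \<le> Z" "Z \<le> real (cells S)"
    using assms(1,8) by auto
  show per: "per_power_feasible S A_per"
    unfolding assms(10)
    using sum_optimal_max_cell_power[OF assms(9)] Z by (intro per_power_feasible_normalized) auto
  fix k l assume kl: "k \<in> {1..users S}" "l \<in> {1..cells S}"
  \<comment> \<open>The bound holds for every feasible \<open>B\<close>, so it passes to the
    supremum without an optimal \<open>B\<close>. The feasible set is nonempty since it contains
    \<open>A_per\<close>.\<close>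
  have "SINR_per_opt S \<le> real (cells S) * SINR S A_per k l"
    unfolding SINR_per_opt_def
  proof (rule cSUP_least)
    show "{A. per_power_feasible S A} \<noteq> {}"
      using per by blast
    fix B assume "B \<in> {A. per_power_feasible S A}"
    then have "min_SINR S B / real (cells S) \<le> SINR S A_per k l"
      unfolding assms(10) using SINR_normalized_ge[OF assms(9) Z kl] by simp
    then show "min_SINR S B \<le> real (cells S) * SINR S A_per k l"
      using cells_pos by (simp add: field_simps)
  qed
  then show "SINR S A_per k l \<ge> 1 / real (cells S) * SINR_per_opt S"
    using cells_pos by (simp add: field_simps)
qed

end
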